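(* Let $C$ be the curve in $\mathbb{R}^3$ whose successive vertices are $$(0,0,0),(0,-1,0),(0,-1,-1),(0,0,-1),(1,0,-1),(1,-1,-1),(1,-1,0),(1,0,0),(2,0,0).$$ Then $C$ can be completed into $2$ equivalent coverings $\mathcal{C}_1,\mathcal{C}_2$ of $\mathbb{R}^3$ by curves which are equivalent to $C$ (that is, $C\in\mathcal{C}_1$, $C\in\mathcal{C}_2$, $\mathcal{C}_1\ne\mathcal{C}_2$). Each $\mathcal{C}_i$ satisfies $4\mathbb{Z}^3+\mathcal{C}_i=\mathcal{C}_i$. For each $\mathcal{C}_i$, each $x\in\mathbb{Z}^3$ is an endpoint of type $0$ (resp. of type $1$) for $6$ curves of $\mathcal{C}_i$ if $x=(2k,2l,2m)$ with $k,l,m\in\mathbb{Z}$ and $k+l+m$ even (resp. odd); no other $x\in\mathbb{Z}^3$ is an endpoint of a curve of $\mathcal{C}_i$.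
   Context: Let $(e_1,e_2,e_3)$ be the canonical basis of $\mathbb{R}^3$. A segment is a non-oriented interval $[x,x+e_i]$ with $x\in\mathbb{Z}^3$, $1\le i\le 3$. A curve is a nonoriented sequence of segments (a sequence and its reversal are the same curve), finite or indexed by $\mathbb{N}$ or by $\mathbb{Z}$, such that (i) two consecutive segments have one and only one common endpoint, and (ii) the common endpoints of a segment with the preceding one and with the following one, when these exist, are different. A curve is self-avoiding if each of its segments appears only once. A set of self-avoiding curves is a covering of $\mathbb{R}^3$ if each segment appears in one and only one of its curves. Two curves, or two sets of curves, are equivalent if one is the image of the other by a positive (orientation-preserving) isometry of $\mathbb{R}^3$. For each curve which is the image of $C$ by a positive isometry, the image of $0$ is called its endpoint of type $0$ and the image of $(2,0,0)=2e_1$ is called its endpoint of type $1$. $4\mathbb{Z}^3+\mathcal{C}_i=\mathcal{C}_i$ means that $\mathcal{C}_i$ is invariant under all translations by vectors of $4\mathbb{Z}^3$. *)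

theory Defs
  imports "HOL-Analysis.Analysis"
begin

definition Z3 :: "(real^3) set" where
  "Z3 = {x. \<forall>i. x $ i \<in> \<int>}"

type_synonym segment = "(real^3) set"

definition segments :: "segment set" where
  "segments = {closed_segment x (x + axis i 1) | x i. x \<in> Z3}"

definition seg_ends :: "segment \<Rightarrow> (real^3) set" where
  "seg_ends a = {p. \<exists>q. a = closed_segment p q}"

text \<open>
  An oriented sequence is a partial map on the integers whose domain is a nonempty interval.
  Bounded, half-bounded and unbounded domains give the finite, \<open>\<nat>\<close>-indexed and
  \<open>\<int>\<close>-indexed sequences. A nonoriented sequence is the class of an oriented one under
  shifts and reversals of the index.
\<close>

type_synonym oriented = "int \<Rightarrow> segment option"
type_synonym curve = "oriented set"

definition is_sequence :: "oriented \<Rightarrow> bool" where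
  "is_sequence s \<longleftrightarrow> dom s \<noteq> {} \<and>
     (\<forall>i\<in>dom s. \<forall>k\<in>dom s. \<forall>j. i \<le> j \<and> j \<le> k \<longrightarrow> j \<in> dom s)"

definition nonoriented :: "oriented \<Rightarrow> curve" where
  "nonoriented s = {t. \<exists>c. t = (\<lambda>i. s (c + i)) \<or> t = (\<lambda>i. s (c - i))}"

definition is_oriented_curve :: "oriented \<Rightarrow> bool" where
  "is_oriented_curve s \<longleftrightarrow>
     is_sequence s \<and> ran s \<subseteq> segments \<and>
     (\<forall>i a b. s i = Some a \<and> s (i + 1) = Some b \<longrightarrow>
        (\<exists>!p. p \<in> seg_ends a \<inter> seg_ends b)) \<and>
     (\<forall>i a b c. s (i - 1) = Some a \<and> s i = Some b \<and> s (i + 1) = Some c \<longrightarrow>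
        seg_ends a \<inter> seg_ends b \<noteq> seg_ends b \<inter> seg_ends c)"

definition is_curve :: "curve \<Rightarrow> bool" where
  "is_curve c \<longleftrightarrow> (\<exists>s. is_oriented_curve s \<and> c = nonoriented s)"

definition self_avoiding :: "curve \<Rightarrow> bool" where
  "self_avoiding c \<longleftrightarrow> (\<forall>s\<in>c. inj_on s (dom s))"

definition curve_segments :: "curve \<Rightarrow> segment set" where
  "curve_segments c = (\<Union>s\<in>c. ran s)"

definition is_covering :: "curve set \<Rightarrow> bool" where
  "is_covering K \<longleftrightarrow>
     (\<forall>c\<in>K. is_curve c \<and> self_avoiding c) \<and>
     (\<forall>a\<in>segments. \<exists>!c. c \<in> K \<and> a \<in> curve_segments c)"

definition positive_isometry :: "(real^3 \<Rightarrow> real^3) \<Rightarrow> bool" where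
  "positive_isometry f \<longleftrightarrow>
     (\<forall>x y. dist (f x) (f y) = dist x y) \<and> det (matrix (\<lambda>x. f x - f 0)) > 0"

definition curve_image :: "(real^3 \<Rightarrow> real^3) \<Rightarrow> curve \<Rightarrow> curve" where
  "curve_image f c = (\<lambda>s. \<lambda>i. map_option (image f) (s i)) ` c"

definition equivalent_curves :: "curve \<Rightarrow> curve \<Rightarrow> bool" where
  "equivalent_curves c d \<longleftrightarrow> (\<exists>f. positive_isometry f \<and> d = curve_image f c)"

definition equivalent_curve_sets :: "curve set \<Rightarrow> curve set \<Rightarrow> bool" where
  "equivalent_curve_sets K L \<longleftrightarrow> (\<exists>f. positive_isometry f \<and> L = curve_image f ` K)"

definition curve_of_vertices :: "(real^3) list \<Rightarrow> curve" where
  "curve_of_vertices vs = nonoriented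
     (\<lambda>i. if 0 \<le> i \<and> i + 1 < int (length vs)
          then Some (closed_segment (vs ! nat i) (vs ! nat (i + 1))) else None)"

definition curve_C :: curve where
  "curve_C = curve_of_vertices
     [vector [0,0,0], vector [0,-1,0], vector [0,-1,-1], vector [0,0,-1], vector [1,0,-1],
      vector [1,-1,-1], vector [1,-1,0], vector [1,0,0], vector [2,0,0]]"

definition endpoint_type0 :: "curve \<Rightarrow> real^3 \<Rightarrow> bool" where
  "endpoint_type0 c x \<longleftrightarrow>
     (\<exists>f. positive_isometry f \<and> c = curve_image f curve_C \<and> x = f 0)"

definition endpoint_type1 :: "curve \<Rightarrow> real^3 \<Rightarrow> bool" where
  "endpoint_type1 c x \<longleftrightarrow>
     (\<exists>f. positive_isometry f \<and> c = curve_image f curve_C \<and> x = f (vector [2,0,0]))"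

end

theory Submission
  imports Defs
begin

text \<open>
  Around every even point \<open>2 (k, l, m)\<close>, \<open>k + l + m\<close> even, put the six images of \<open>C\<close> under the
  group of rotations preserving the axis \<open>(1, 1, 1)\<close>, all followed by one diagonal sign change
  that depends on the parities of \<open>k, l, m\<close>. Two of the possible sign rules give a covering; a
  rotation of the group that reverses the axis exchanges them. A segment is determined by its
  doubled midpoint, an integer point with exactly one odd coordinate, and the doubled midpoints of
  these curves are invariant under \<open>8 \<int>\<^sup>3\<close>, so that the covering property amounts to the fact that
  the 24 curves with 8 segments each in a fundamental domain hit each of the 192 residue
  classes exactly once. No isometry reverses \<open>C\<close>, so the image of \<open>C\<close> under an isometry determines
  the images of its vertices; this gives the statements on endpoints.
\<close>

section \<open>Curves given by their vertices\<close>

definition path_of :: "(real^3) list \<Rightarrow> oriented" where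
  "path_of vs = (\<lambda>i. if 0 \<le> i \<and> i + 1 < int (length vs)
     then Some (closed_segment (vs ! nat i) (vs ! nat (i + 1))) else None)"

lemma curve_of_vertices_path_of: "curve_of_vertices vs = nonoriented (path_of vs)"
  by (simp add: curve_of_vertices_def path_of_def)

lemma seg_ends_closed_segment: "seg_ends (closed_segment p q) = {p, q}"
  unfolding seg_ends_def by (auto simp: doubleton_eq_iff)

lemma dom_path_of: "dom (path_of vs) = {0..<int (length vs) - 1}"
  by (auto simp: path_of_def split: if_splits)

lemma path_of_eq_Some_iff:
  "path_of vs i = Some a \<longleftrightarrow>
    (\<exists>n. i = int n \<and> Suc n < length vs \<and> a = closed_segment (vs ! n) (vs ! Suc n))"
proof (cases "0 \<le> i")
  case True
  then obtain n where "i = int n" by (metis nonneg_int_cases)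
  moreover have "nat (int n + 1) = Suc n" by simp
  ultimately show ?thesis by (auto simp: path_of_def)
qed (auto simp: path_of_def)

lemma path_of_of_nat:
  "Suc n < length vs \<Longrightarrow> path_of vs (int n) = Some (closed_segment (vs ! n) (vs ! Suc n))"
  by (simp add: path_of_eq_Some_iff)

lemma path_in_nonoriented: "s \<in> nonoriented s"
  unfolding nonoriented_def by (rule CollectI, rule exI[of _ 0]) simp

text \<open>Shifting or reversing the index permutes the integers, so every oriented representative
  has the same range.\<close>

lemma curve_segments_curve_of_vertices:
  "curve_segments (curve_of_vertices vs) =
    {closed_segment (vs ! n) (vs ! Suc n) | n. Suc n < length vs}"
proof -
  have "ran s = ran (path_of vs)" if "s \<in> nonoriented (path_of vs)" for s
  proof -
    have "s i \<in> range (path_of vs)" and "path_of vs i \<in> range s" for i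
    proof -
      from that obtain c
        where "s = (\<lambda>i. path_of vs (c + i)) \<or> s = (\<lambda>i. path_of vs (c - i))"
        unfolding nonoriented_def by blast
      \<comment> \<open>The index maps \<open>c + i\<close> and \<open>c - i\<close> are inverted by
        \<open>i - c\<close> and \<open>c - i\<close>, which gives both inclusions of
        ranges.\<close>
      then have "path_of vs i = s (i - c) \<or> path_of vs i = s (c - i)"
          "s i = path_of vs (c + i) \<or> s i = path_of vs (c - i)" by auto
      then show "s i \<in> range (path_of vs)" "path_of vs i \<in> range s"
        by (metis rangeI)+
    qed
    then have "range s = range (path_of vs)" by blast
    moreover have "ran t = Some -` range t" for t :: oriented
    proof -
      have "a \<in> ran t \<longleftrightarrow> a \<in> Some -` range t" for a
        unfolding ran_def vimage_def image_def mem_Collect_eq by (metis UNIV_I)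
      then show ?thesis by blast
    qed
    ultimately show ?thesis by simp
  qed
  then have "curve_segments (curve_of_vertices vs) = ran (path_of vs)"
    unfolding curve_segments_def curve_of_vertices_path_of using path_in_nonoriented by blast
  then show ?thesis by (auto simp: ran_def path_of_eq_Some_iff)
qed

text \<open>Consecutive segments share the vertex between them, and distinctness leaves no other
  common end. Condition (ii) then says that two successive inner vertices differ.\<close>

lemma is_curve_curve_of_vertices:
  assumes "distinct vs" "2 \<le> length vs"
    and unit: "\<And>n. Suc n < length vs \<Longrightarrow> closed_segment (vs ! n) (vs ! Suc n) \<in> segments"
  shows "is_curve (curve_of_vertices vs)"
proof -
  have neq: "vs ! m \<noteq> vs ! n" if "m < length vs" "n < length vs" "m \<noteq> n" for m n
    using that assms(1) by (simp add: nth_eq_iff_index_eq)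
  have seq: "is_sequence (path_of vs)"
    unfolding is_sequence_def dom_path_of using assms(2) by auto
  have ran: "ran (path_of vs) \<subseteq> segments"
    using unit by (auto simp: ran_def path_of_eq_Some_iff)
  have common: "seg_ends a \<inter> seg_ends b = {vs ! Suc (nat i)}"
      "0 \<le> i" "Suc (Suc (nat i)) < length vs"
    if ab: "path_of vs i = Some a" "path_of vs (i + 1) = Some b" for i a b
  proof -
    obtain n where n: "i = int n" "Suc n < length vs" "a = closed_segment (vs ! n) (vs ! Suc n)"
      using ab(1) by (auto simp: path_of_eq_Some_iff)
    obtain k where k: "i + 1 = int k" "Suc k < length vs"
        "b = closed_segment (vs ! k) (vs ! Suc k)"
      using ab(2) by (auto simp: path_of_eq_Some_iff)
    have "k = Suc n" using n(1) k(1) by linarith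
    note k = k(2,3)[unfolded this]
    show "seg_ends a \<inter> seg_ends b = {vs ! Suc (nat i)}" "0 \<le> i"
        "Suc (Suc (nat i)) < length vs"
      using n k neq[of n "Suc n"] neq[of n "Suc (Suc n)"] neq[of "Suc n" "Suc (Suc n)"]
      by (auto simp: seg_ends_closed_segment)
  qed
  have one: "\<exists>!p. p \<in> seg_ends a \<inter> seg_ends b"
    if "path_of vs i = Some a" "path_of vs (i + 1) = Some b" for i a b
    unfolding common(1)[OF that] by simp
  have different: "seg_ends a \<inter> seg_ends b \<noteq> seg_ends b \<inter> seg_ends c"
    if "path_of vs (i - 1) = Some a" "path_of vs i = Some b" "path_of vs (i + 1) = Some c"
    for i a b c
  proof -
    have "vs ! Suc (nat (i - 1)) \<noteq> vs ! Suc (nat i)"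
      using common(2,3)[of "i - 1" a b] common(3)[of i b c] that by (intro neq) auto
    then show ?thesis
      using common(1)[of "i - 1" a b] common(1)[of i b c] that by simp
  qed
  have "is_oriented_curve (path_of vs)"
    unfolding is_oriented_curve_def using seq ran
    by (intro conjI allI impI; (elim conjE)?) (use one different in auto)
  then show ?thesis
    unfolding is_curve_def curve_of_vertices_path_of by blast
qed

text \<open>Equal segments have equal end pairs. Matched in parallel, the indices agree; matched
  crosswise, they would satisfy n = m + 1 and m = n + 1.\<close>

lemma self_avoiding_curve_of_vertices:
  assumes "distinct vs"
  shows "self_avoiding (curve_of_vertices vs)"
proof -
  have inj: "i = j" if "path_of vs i = path_of vs j" "path_of vs i = Some a" for i j a
  proof -
    have "path_of vs j = Some a" using that by simp
    with that(2) show ?thesis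
      using assms by (auto simp: path_of_eq_Some_iff doubleton_eq_iff nth_eq_iff_index_eq)
  qed
  have "inj_on s (dom s)" if "s \<in> nonoriented (path_of vs)" for s
  proof (rule inj_onI)
    fix i j assume "i \<in> dom s" "s i = s j"
    then obtain a where "s i = Some a" "s i = s j" by blast
    moreover from that obtain c
      where "s = (\<lambda>i. path_of vs (c + i)) \<or> s = (\<lambda>i. path_of vs (c - i))"
      unfolding nonoriented_def by blast
    ultimately have "c + i = c + j \<or> c - i = c - j" using inj by fast
    then show "i = j" by auto
  qed
  then show ?thesis
    unfolding self_avoiding_def curve_of_vertices_path_of by blast
qed

text \<open>An inner vertex is the only common end of its two segments, so the segments determine
  it. With at least one inner vertex known, the first and last vertices are the remaining ends of
  the outer segments; a single segment would leave its direction open.\<close>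

lemma path_of_inject:
  assumes "distinct us" "distinct vs" "length us = length vs" "3 \<le> length vs"
    and eq: "path_of us = path_of vs"
  shows "us = vs"
proof -
  have pair: "{us ! n, us ! Suc n} = {vs ! n, vs ! Suc n}" if "Suc n < length vs" for n
    using fun_cong[OF eq, of "int n"] that assms(3) by (simp add: path_of_of_nat)
  have neq: "us ! m \<noteq> us ! n" "vs ! m \<noteq> vs ! n"
    if "m < length vs" "n < length vs" "m \<noteq> n" for m n
    using that assms(1-3) by (simp_all add: nth_eq_iff_index_eq)
  have inner: "us ! Suc n = vs ! Suc n" if "Suc (Suc n) < length vs" for n
    using pair[of n] pair[of "Suc n"] that neq[of n "Suc n"] neq[of n "Suc (Suc n)"]
    by (auto simp: doubleton_eq_iff)
  have "us ! n = vs ! n" if "n < length vs" for n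
  proof -
    consider "n = 0" | "0 < n" "Suc n < length vs" | "Suc n = length vs"
      using \<open>n < length vs\<close> by linarith
    then show ?thesis
    proof cases
      case 1
      then show ?thesis using pair[of 0] inner[of 0] assms(4) by (auto simp: doubleton_eq_iff)
    next
      case 2
      then show ?thesis using inner[of "n - 1"] by simp
    next
      case 3
      then obtain m where "n = Suc (Suc m)"
        using assms(4) by (metis Suc_le_mono numeral_3_eq_3 Suc_le_D)
      then show ?thesis using 3 pair[of "Suc m"] inner[of m] by (auto simp: doubleton_eq_iff)
    qed
  qed
  then show ?thesis using assms(3) by (simp add: list_eq_iff_nth_eq)
qed

text \<open>A list of n vertices has segments numbered 0 to n - 2, hence the reflection i to n - 2 -
  i.\<close>

lemma path_of_rev: "path_of (rev vs) i = path_of vs (int (length vs) - 2 - i)"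
proof (cases "0 \<le> i \<and> i + 1 < int (length vs)")
  case True
  define n where "n = nat i"
  have n: "i = int n" "Suc n < length vs" using True by (auto simp: n_def)
  then have *: "int (length vs) - 2 - i = int (length vs - Suc (Suc n))" by simp
  have "path_of vs (int (length vs - Suc (Suc n))) =
      Some (closed_segment (vs ! (length vs - Suc (Suc n))) (vs ! (length vs - Suc n)))"
    using n(2) by (subst path_of_of_nat) (simp_all add: Suc_diff_Suc)
  then show ?thesis
    unfolding * unfolding n(1) using n(2)
    by (simp add: path_of_of_nat rev_nth closed_segment_commute)
qed (auto simp: path_of_def)

text \<open>Equal classes differ by a shift or a reflected shift, and the finite domains leave one
  value for the shift in each case.\<close>

lemma curve_of_vertices_inject:
  assumes "distinct us" "distinct vs" "length us = length vs" "3 \<le> length vs"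
    and "curve_of_vertices us = curve_of_vertices vs"
  shows "us = vs \<or> us = rev vs"
proof -
  let ?n = "int (length vs)"
  have "path_of us \<in> nonoriented (path_of vs)"
    using assms(5) path_in_nonoriented by (auto simp: curve_of_vertices_path_of)
  then obtain c where
    "path_of us = (\<lambda>i. path_of vs (c + i)) \<or> path_of us = (\<lambda>i. path_of vs (c - i))"
    by (auto simp: nonoriented_def)
  then show ?thesis
  proof
    assume eq: "path_of us = (\<lambda>i. path_of vs (c + i))"
    have "c + i \<in> dom (path_of vs)" if "i \<in> dom (path_of us)" for i
      using that unfolding eq by (auto simp: dom_def)
    \<comment> \<open>Both extreme indices 0 and n - 2 must stay inside the domain, which bounds
      \<open>c\<close> from both sides.\<close>
    from this[of 0] this[of "?n - 2"] have "c = 0"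
      using assms(3,4) by (simp add: dom_path_of)
    then show ?thesis using path_of_inject[OF assms(1-4)] eq by simp
  next
    assume eq: "path_of us = (\<lambda>i. path_of vs (c - i))"
    have "c - i \<in> dom (path_of vs)" if "i \<in> dom (path_of us)" for i
      using that unfolding eq by (auto simp: dom_def)
    from this[of 0] this[of "?n - 2"] have "c = ?n - 2"
      using assms(3,4) by (simp add: dom_path_of)
    then have "path_of us = path_of (rev vs)"
      unfolding eq by (simp add: path_of_rev fun_eq_iff)
    then show ?thesis using path_of_inject[of us "rev vs"] assms by simp
  qed
qed

section \<open>Images under positive isometries\<close>

text \<open>After subtracting \<open>f 0\<close> an isometry is orthogonal, hence linear, and linear
  maps and translations carry segments to segments.\<close>

lemma positive_isometry_closed_segment:
  assumes "positive_isometry f"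
  shows "f ` closed_segment u v = closed_segment (f u) (f v)"
proof -
  let ?g = "\<lambda>x. f x - f 0"
  have "orthogonal_transformation ?g"
    using assms by (auto simp: orthogonal_transformation_isometry positive_isometry_def dist_norm)
  then have "linear ?g" by (rule orthogonal_transformation_linear)
  then have "?g ` closed_segment u v = closed_segment (?g u) (?g v)"
    by (rule closed_segment_linear_image[symmetric])
  then have "(+) (f 0) ` ?g ` closed_segment u v = closed_segment (f u) (f v)"
    by (simp flip: closed_segment_translation)
  then show ?thesis by (simp add: image_image)
qed

lemma nonoriented_comp: "(\<lambda>s i. h (s i)) ` nonoriented s = nonoriented (\<lambda>i. h (s i))"
proof -
  have "nonoriented s = range (\<lambda>c i. s (c + i)) \<union> range (\<lambda>c i. s (c - i))" for s :: oriented
    unfolding nonoriented_def by blast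
  then show ?thesis by (simp add: image_Un image_image)
qed

lemma curve_image_curve_of_vertices:
  assumes "positive_isometry f"
  shows "curve_image f (curve_of_vertices vs) = curve_of_vertices (map f vs)"
proof -
  have "(\<lambda>i. map_option (image f) (path_of vs i)) = path_of (map f vs)"
    by (rule ext) (auto simp: path_of_def positive_isometry_closed_segment[OF assms])
  then show ?thesis
    unfolding curve_image_def curve_of_vertices_path_of
    by (simp add: nonoriented_comp)
qed

lemma curve_image_comp: "curve_image f (curve_image g c) = curve_image (\<lambda>x. f (g x)) c"
  by (simp add: curve_image_def image_image option.map_comp comp_def)

section \<open>Motions of the integer lattice\<close>

type_synonym 'a triple = "'a \<times> 'a \<times> 'a"

definition pt :: "int triple \<Rightarrow> real^3" where
  "pt = (\<lambda>(x, y, z). vector [of_int x, of_int y, of_int z])"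

text \<open>Entries 0 to 2 are the rotations about (1,1,1); entries 3 to 5 are half turns about axes
  orthogonal to it. The ring is left open because the same formulas act on integer vertices and, in
  \<open>motion\<close>, on real coordinates.\<close>

definition turn :: "nat \<Rightarrow> 'a::ring_1 triple \<Rightarrow> 'a triple" where
  "turn r = (\<lambda>(x, y, z).
    [(x, y, z), (y, z, x), (z, x, y), (- x, - z, - y), (- y, - x, - z), (- z, - y, - x)] ! r)"

definition sg :: "int \<Rightarrow> 'a::ring_1" where
  "sg k = (if even k then 1 else - 1)"

text \<open>The two sign rules are the ones found by an exact cover search modulo \<open>4\<close>.\<close>

definition flip :: "bool \<Rightarrow> int triple \<Rightarrow> 'a::ring_1 triple \<Rightarrow> 'a triple" where
  "flip b = (\<lambda>(k, l, m) (x, y, z).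
    if b then (sg l * x, sg m * y, sg k * z) else (sg m * x, sg k * y, sg l * z))"

definition lin :: "bool \<Rightarrow> int triple \<Rightarrow> nat \<Rightarrow> 'a::ring_1 triple \<Rightarrow> 'a triple" where
  "lin b k r v = flip b k (turn r v)"

definition motion :: "bool \<Rightarrow> int triple \<Rightarrow> nat \<Rightarrow> real^3 \<Rightarrow> real^3" where
  "motion b k r x =
    (case lin b k r (x $ 1, x $ 2, x $ 3) of (u, v, w) \<Rightarrow> vector [u, v, w]) + pt (k + k)"

definition even3 :: "int triple \<Rightarrow> bool" where
  "even3 = (\<lambda>(k, l, m). even (k + l + m))"

lemma vec3_eq_iff: "(x :: 'a^3) = y \<longleftrightarrow> x $ 1 = y $ 1 \<and> x $ 2 = y $ 2 \<and> x $ 3 = y $ 3"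
  by (simp add: vec_eq_iff forall_3)

lemma pt_eq_iff [simp]: "pt u = pt v \<longleftrightarrow> u = v"
  by (auto simp: pt_def vec3_eq_iff split: prod.splits)

lemma pt_add: "pt (u + v) = pt u + pt v"
  by (auto simp: pt_def vec3_eq_iff split: prod.splits)

lemma Z3_eq_range_pt: "Z3 = range pt"
proof (rule set_eqI)
  fix x :: "real^3"
  have "x = pt (a, b, c) \<longleftrightarrow> x $ 1 = of_int a \<and> x $ 2 = of_int b \<and> x $ 3 = of_int c" for a b c
    by (simp add: pt_def vec3_eq_iff)
  moreover have "x \<in> range pt \<longleftrightarrow> (\<exists>a b c. x = pt (a, b, c))"
    unfolding image_def by simp
  ultimately show "x \<in> Z3 \<longleftrightarrow> x \<in> range pt"
    unfolding Z3_def by (simp add: forall_3 Ints_def image_def)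
qed

lemma less_6_cases:
  fixes r :: nat
  assumes "r < 6"
  obtains "r = 0" | "r = 1" | "r = 2" | "r = 3" | "r = 4" | "r = 5"
  using assms by linarith

lemma turn_simps [simp]:
  "turn 0 (x, y, z) = (x, y, z)" "turn (Suc 0) (x, y, z) = (y, z, x)"
  "turn 2 (x, y, z) = (z, x, y)" "turn 3 (x, y, z) = (- x, - z, - y)"
  "turn 4 (x, y, z) = (- y, - x, - z)" "turn 5 (x, y, z) = (- z, - y, - x)"
  by (simp_all add: turn_def)

lemma motion_pt: "r < 6 \<Longrightarrow> motion b k r (pt v) = pt (lin b k r v + (k + k))"
  by (erule less_6_cases; cases k; cases v)
    (auto simp: motion_def pt_def lin_def flip_def sg_def vec3_eq_iff)

text \<open>Signed permutations preserve distances. Each \<open>turn\<close> has determinant 1, and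
  the three signs multiply to (-1)^(i+j+l), which is 1 by \<open>even3\<close>.\<close>

lemma positive_isometry_motion:
  assumes "r < 6" "even3 k"
  shows "positive_isometry (motion b k r)"
proof -
  obtain i j l where k: "k = (i, j, l)" by (cases k)
  have par: "even l \<longleftrightarrow> (even i \<longleftrightarrow> even j)" using assms(2) by (auto simp: k even3_def)
  have "dist (motion b k r x) (motion b k r y) = dist x y" for x y
    using assms(1)
    by (rule less_6_cases; cases b; cases "even i"; cases "even j"; cases "even l")
      (simp_all add: k motion_def lin_def flip_def sg_def dist_vec_def L2_set_def sum_3 dist_minus)
  moreover have "det (matrix (\<lambda>x. motion b k r x - motion b k r 0)) > 0"
    using assms(1)
    by (rule less_6_cases; cases b; cases "even i"; cases "even j")
      (simp_all add: par k motion_def lin_def flip_def sg_def det_3 matrix_def axis_def)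
  ultimately show ?thesis by (simp add: positive_isometry_def)
qed

lemma lin_add: "r < 6 \<Longrightarrow> lin b k r (u + v) = lin b k r u + lin b k r v"
  for u v :: "int triple"
  by (erule less_6_cases; cases k; cases u; cases v)
    (auto simp: lin_def flip_def sg_def)

lemma lin_eq_iff: "r < 6 \<Longrightarrow> lin b k r u = lin b k r v \<longleftrightarrow> u = v"
  for u v :: "int triple"
  by (erule less_6_cases; cases k; cases u; cases v)
    (auto simp: lin_def flip_def sg_def)

section \<open>Segments as doubled midpoints\<close>

definition one_odd :: "int triple \<Rightarrow> bool" where
  "one_odd = (\<lambda>(x, y, z). odd x \<and> even y \<and> even z \<or> even x \<and> odd y \<and> even z \<or>
    even x \<and> even y \<and> odd z)"

text \<open>For a doubled midpoint m, rounding m/2 down and up recovers the two ends of the segment,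
  as they differ only in the odd coordinate.\<close>

definition lo :: "int triple \<Rightarrow> int triple" where
  "lo = (\<lambda>(x, y, z). (x div 2, y div 2, z div 2))"

definition hi :: "int triple \<Rightarrow> int triple" where
  "hi = (\<lambda>(x, y, z). ((x + 1) div 2, (y + 1) div 2, (z + 1) div 2))"

definition edge :: "int triple \<Rightarrow> segment" where
  "edge m = closed_segment (pt (lo m)) (pt (hi m))"

definition units :: "int triple set" where
  "units = {(1, 0, 0), (0, 1, 0), (0, 0, 1)}"

definition adjacent :: "int triple \<Rightarrow> int triple \<Rightarrow> bool" where
  "adjacent u v \<longleftrightarrow> v - u \<in> units \<or> u - v \<in> units"

lemma lo_plus_hi: "lo m + hi m = m"
  by (cases m) (simp add: lo_def hi_def, presburger)

lemma hi_minus_lo: "one_odd m \<Longrightarrow> hi m - lo m \<in> units"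
  by (cases m) (auto simp: one_odd_def lo_def hi_def units_def elim!: evenE oddE)

lemma one_odd_add:
  assumes "adjacent u v"
  shows "one_odd (u + v)"
proof -
  have "one_odd (u + v)" if "v - u \<in> units" for u v
  proof -
    define e where "e = v - u"
    then have e: "e \<in> units" "v = u + e" using that by simp_all
    then show ?thesis by (cases u) (auto simp: units_def one_odd_def)
  qed
  from this[of v u] this[of u v] show ?thesis
    using assms by (auto simp: adjacent_def add.commute)
qed

text \<open>If v = u + e with a unit vector e, the sum is 2u + e, and rounding its half down and up
  returns u and v.\<close>

lemma closed_segment_eq_edge:
  assumes "adjacent u v"
  shows "closed_segment (pt u) (pt v) = edge (u + v)"
proof -
  have *: "closed_segment (pt u) (pt v) = edge (u + v)" if "v - u \<in> units" for u v
  proof -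
    define e where "e = v - u"
    then have e: "e \<in> units" "v = u + e" using that by simp_all
    then have "lo (u + v) = u" "hi (u + v) = v"
      by (cases u; auto simp: units_def lo_def hi_def)+
    then show ?thesis by (simp add: edge_def)
  qed
  from *[of v u] *[of u v] show ?thesis
    using assms by (auto simp: adjacent_def add.commute closed_segment_commute)
qed

text \<open>A segment determines its pair of ends, whose sum is m.\<close>

lemma inj_edge: "inj edge"
proof
  fix m n assume "edge m = edge n"
  then have "{lo m, hi m} = {lo n, hi n}"
    by (auto simp: edge_def doubleton_eq_iff)
  then have "lo m + hi m = lo n + hi n"
    by (auto simp: doubleton_eq_iff add.commute)
  then show "m = n" by (simp only: lo_plus_hi)
qed

lemma segments_eq: "segments = edge ` {m. one_odd m}"
proof -
  have axes: "{axis i 1 :: real^3 | i. True} = pt ` units"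
  proof -
    have "axis 1 1 = pt (1, 0, 0)" "axis 2 1 = pt (0, 1, 0)" "axis 3 1 = pt (0, 0, 1)"
      by (simp_all add: pt_def vec3_eq_iff axis_def)
    then show ?thesis unfolding units_def by (auto simp: image_iff) (metis exhaust_3)+
  qed
  have "segments = {closed_segment x (x + e) | x e. x \<in> Z3 \<and> e \<in> {axis i 1 | i. True}}"
    unfolding segments_def by blast
  also have "\<dots> = {closed_segment (pt u) (pt (u + e)) | u e. e \<in> units}"
    unfolding axes Z3_eq_range_pt pt_add by blast
  also have "\<dots> = edge ` {m. one_odd m}"
  proof safe
    fix u e assume "e \<in> units"
    then have "adjacent u (u + e)" by (simp add: adjacent_def)
    then show "closed_segment (pt u) (pt (u + e)) \<in> edge ` {m. one_odd m}"
      using closed_segment_eq_edge one_odd_add by blast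
  next
    fix m assume "one_odd m"
    then have "hi m - lo m \<in> units" by (rule hi_minus_lo)
    moreover have "edge m = closed_segment (pt (lo m)) (pt (lo m + (hi m - lo m)))"
      by (simp add: edge_def)
    ultimately show "\<exists>u e. edge m = closed_segment (pt u) (pt (u + e)) \<and> e \<in> units" by blast
  qed
  finally show ?thesis .
qed

text \<open>The linear part is a signed permutation, so it sends a unit vector to plus or minus a
  unit vector; the symmetry of \<open>adjacent\<close> absorbs the sign.\<close>

lemma adjacent_lin:
  assumes "r < 6" "adjacent u v"
  shows "adjacent (lin b k r u + c) (lin b k r v + c)"
proof -
  have *: "lin b k r e \<in> units \<or> - lin b k r e \<in> units" if "e \<in> units" for e
    using assms(1) that
    by (elim less_6_cases; cases k; cases b) (auto simp: lin_def flip_def sg_def units_def)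
  have neg: "lin b k r (- e) = - lin b k r e" for e :: "int triple"
    using assms(1) by (elim less_6_cases; cases k; cases e) (auto simp: lin_def flip_def sg_def)
  have "lin b k r v - lin b k r u = lin b k r (v - u)"
    using lin_add[OF assms(1), of b k v "- u"] neg[of u] by simp
  then have "(lin b k r v + c) - (lin b k r u + c) = lin b k r (v - u)" by simp
  moreover from this have "(lin b k r u + c) - (lin b k r v + c) = - lin b k r (v - u)"
    by (metis minus_diff_eq)
  moreover have "v - u \<in> units \<or> - (v - u) \<in> units"
    using assms(2) by (simp add: adjacent_def)
  ultimately show ?thesis
    unfolding adjacent_def using *[of "v - u"] *[of "- (v - u)"] neg[of "v - u"] by auto
qed

text \<open>A doubled midpoint is the sum of the two ends, so the translation by 2k enters twice and
  becomes 4k.\<close>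

lemma motion_edge:
  assumes "r < 6" "even3 k" "one_odd m"
  shows "motion b k r ` edge m = edge (lin b k r m + (k + k + k + k))"
    and "one_odd (lin b k r m + (k + k + k + k))"
proof -
  let ?u = "lin b k r (lo m) + (k + k)" and ?v = "lin b k r (hi m) + (k + k)"
  have "adjacent (lo m) (hi m)" using hi_minus_lo[OF assms(3)] by (simp add: adjacent_def)
  then have adj: "adjacent ?u ?v" using assms(1) adjacent_lin by blast
  have "?u + ?v = lin b k r (lo m + hi m) + (k + k + k + k)"
    using assms(1) by (simp add: lin_add)
  then have sum: "?u + ?v = lin b k r m + (k + k + k + k)" by (simp add: lo_plus_hi)
  have "motion b k r ` edge m = closed_segment (pt ?u) (pt ?v)"
    unfolding edge_def
      positive_isometry_closed_segment[OF positive_isometry_motion[OF assms(1,2)]]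
    using assms(1) by (simp add: motion_pt)
  then show "motion b k r ` edge m = edge (lin b k r m + (k + k + k + k))"
    using closed_segment_eq_edge[OF adj] sum by simp
  show "one_odd (lin b k r m + (k + k + k + k))"
    using one_odd_add[OF adj] sum by simp
qed

section \<open>The table of doubled midpoints modulo 8\<close>

declare split_paired_Ex [simp del] split_paired_All [simp del]

definition verts :: "int triple list" where
  "verts = [(0, 0, 0), (0, - 1, 0), (0, - 1, - 1), (0, 0, - 1), (1, 0, - 1), (1, - 1, - 1),
    (1, - 1, 0), (1, 0, 0), (2, 0, 0)]"

text \<open>The sums of consecutive entries of \<open>verts\<close>: the doubled midpoints of the
  eight segments of C.\<close>

definition mids :: "int triple list" where
  "mids = [(0, - 1, 0), (0, - 2, - 1), (0, - 1, - 2), (1, 0, - 2), (2, - 1, - 2), (2, - 2, - 1),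
    (2, - 1, 0), (3, 0, 0)]"

definition mod8 :: "int triple \<Rightarrow> int triple" where
  "mod8 = (\<lambda>(x, y, z). (x mod 8, y mod 8, z mod 8))"

text \<open>Only a sorting key: the product order of the library is not linear on triples.\<close>

definition encode :: "int triple \<Rightarrow> int" where
  "encode = (\<lambda>(x, y, z). 64 * x + 8 * y + z)"

definition residue :: "bool \<Rightarrow> int triple \<times> nat \<times> int triple \<Rightarrow> int triple" where
  "residue b = (\<lambda>(k, r, w). mod8 (lin b k r w + (k + k + k + k)))"

text \<open>The four triples represent the parity classes with even sum. The list has 4 * 6 * 8 =
  192 entries, as many as the residues modulo 8 with one odd coordinate (3 * 4 * 4 * 4).\<close>

definition places :: "(int triple \<times> nat \<times> int triple) list" where
  "places = List.product [(0, 0, 0), (0, 1, 1), (1, 0, 1), (1, 1, 0)]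
    (List.product [0..<6] mids)"

definition one_odd_residues :: "int triple list" where
  "one_odd_residues = filter one_odd (List.product [0..7] (List.product [0..7] [0..7]))"

text \<open>The finite core, settled by evaluation. \<open>one_odd_residues\<close> is
  repetition-free and already increasing for \<open>encode\<close>, so this equality says that every
  residue is hit exactly once.\<close>

lemma sort_residues: "sort_key encode (map (residue b) places) = one_odd_residues"
proof (cases b)
  case True
  have "sort_key encode (map (residue True) places) = one_odd_residues" by code_simp
  with True show ?thesis by simp
next
  case False
  have "sort_key encode (map (residue False) places) = one_odd_residues" by code_simp
  with False show ?thesis by simp
qed

lemma set_places:
  "set places = {(0, 0, 0), (0, 1, 1), (1, 0, 1), (1, 1, 0)} \<times> {..<6} \<times> set mids"
  unfolding places_def by (auto simp: lessThan_atLeast0)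

text \<open>Sorting preserves distinctness and the set of entries: the first gives injectivity, the
  second surjectivity.\<close>

lemma bij_betw_residue:
  "bij_betw (residue b) (set places) {m. one_odd m \<and> mod8 m = m}"
proof -
  have "distinct one_odd_residues" by (simp add: one_odd_residues_def distinct_product)
  then have "distinct (map (residue b) places)"
    by (metis sort_residues distinct_sort)
  moreover have "set one_odd_residues = {m. one_odd m \<and> mod8 m = m}"
    by (auto simp: one_odd_residues_def mod8_def mod_eq_self_iff_div_eq_0 div_eq_0_iff)
  then have "residue b ` set places = {m. one_odd m \<and> mod8 m = m}"
    by (metis sort_residues set_sort set_map)
  ultimately show ?thesis by (simp add: bij_betw_def distinct_map)
qed

definition red :: "int triple \<Rightarrow> int triple" where
  "red = (\<lambda>(k, l, m). (k mod 2, l mod 2, m mod 2))"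

text \<open>The signs see only parities. This is what lets a finite table decide about all
  k.\<close>

lemma lin_red [simp]: "lin b (red k) r w = lin b k r w"
  by (cases k; cases "turn r w") (simp add: lin_def flip_def sg_def red_def)

text \<open>Replacing k by its remainder modulo 2 changes 4k by a multiple of 8 and keeps the linear
  part.\<close>

lemma residue_red: "residue b (red k, r, w) = mod8 (lin b k r w + (k + k + k + k))"
proof -
  have *: "(x + (i mod 2 + i mod 2 + i mod 2 + i mod 2)) mod 8 = (x + (i + i + i + i)) mod 8"
    for x i :: int
  proof -
    have "x + (i + i + i + i) = x + (i mod 2 + i mod 2 + i mod 2 + i mod 2) + 8 * (i div 2)"
      using mult_div_mod_eq[of 2 i] by linarith
    then show ?thesis by (simp only: mod_mult_self2)
  qed
  have "residue b (red k, r, w) = mod8 (lin b k r w + (red k + red k + red k + red k))"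
    by (simp add: residue_def)
  then show ?thesis
    by (cases k; cases "lin b k r w") (simp only: mod8_def red_def * add_Pair prod.case)
qed

lemma red_even3: "even3 k \<Longrightarrow> red k \<in> {(0, 0, 0), (0, 1, 1), (1, 0, 1), (1, 1, 0)}"
  by (cases k) (auto simp: even3_def red_def mod_2_eq_odd)

text \<open>The table lifted from residues to all integer triples: every segment lies on exactly one
  placed copy of C, at exactly one position. Both the covering property and the distinctness of the
  copies rest on it.\<close>

lemma ex1_place:
  assumes "one_odd m"
  shows "\<exists>!(k, r, w). even3 k \<and> r < 6 \<and> w \<in> set mids \<and> lin b k r w + (k + k + k + k) = m"
proof -
  have "even (x mod 8) = even x" for x :: int by presburger
  then have "one_odd (mod8 m)" "mod8 (mod8 m) = mod8 m"
    using assms by (cases m; simp add: one_odd_def mod8_def)+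
  then have "mod8 m \<in> residue b ` set places"
    using bij_betw_imp_surj_on[OF bij_betw_residue[of b]] by simp
  then obtain a r w where arw: "(a, r, w) \<in> set places" "residue b (a, r, w) = mod8 m"
    by force
  obtain a1 a2 a3 where a: "a = (a1, a2, a3)" by (cases a)
  obtain m1 m2 m3 where m: "m = (m1, m2, m3)" by (cases m)
  obtain l1 l2 l3 where l: "lin b a r w = (l1, l2, l3)" by (cases "lin b a r w")
  \<comment> \<open>The table matches m modulo 8. Adding to \<open>a\<close> twice the remaining
    quotient by 8 shifts 4a by the missing multiple of 8 and keeps all parities, hence the linear
    part.\<close>
  define k where "k = (a1 + 2 * ((m1 - (l1 + 4 * a1)) div 8), a2 + 2 * ((m2 - (l2 + 4 * a2)) div 8),
    a3 + 2 * ((m3 - (l3 + 4 * a3)) div 8))"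
  have "red k = red a" by (simp add: k_def a red_def)
  then have lin: "lin b k r w = (l1, l2, l3)"
    using lin_red[of b k r w] lin_red[of b a r w] l by simp
  have "(l1 + 4 * a1) mod 8 = m1 mod 8" "(l2 + 4 * a2) mod 8 = m2 mod 8"
      "(l3 + 4 * a3) mod 8 = m3 mod 8"
    using arw(2) l by (simp_all add: residue_def a m mod8_def)
  moreover have "x + 8 * ((y - x) div 8) = y" if "x mod 8 = y mod 8" for x y :: int
    using that mod_eq_dvd_iff[of y 8 x] by simp
  ultimately have "l1 + 4 * a1 + 8 * ((m1 - (l1 + 4 * a1)) div 8) = m1"
      "l2 + 4 * a2 + 8 * ((m2 - (l2 + 4 * a2)) div 8) = m2"
      "l3 + 4 * a3 + 8 * ((m3 - (l3 + 4 * a3)) div 8) = m3" by blast+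
  then have eqm: "lin b k r w + (k + k + k + k) = m"
    unfolding lin unfolding k_def m add_Pair prod.inject by linarith
  have krw: "even3 k" "r < 6" "w \<in> set mids"
    using arw(1) by (auto simp: set_places k_def a even3_def)
  have unique: "k' = k \<and> r' = r \<and> w' = w"
    if k': "even3 k'" "r' < 6" "w' \<in> set mids" "lin b k' r' w' + (k' + k' + k' + k') = m"
    for k' r' w'
  proof -
    \<comment> \<open>Two solutions reduce to table entries with the same residue, so they share
      parity class, rotation and midpoint. Their linear parts then agree, and cancelling leaves 4k'
      = 4k.\<close>
    have "(red k', r', w') \<in> set places" "(red k, r, w) \<in> set places"
      using red_even3 k' krw unfolding set_places by blast+
    moreover have "residue b (red k', r', w') = residue b (red k, r, w)"
      using k'(4) eqm by (simp add: residue_red)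
    ultimately have eq: "red k' = red k" "r' = r" "w' = w"
      using bij_betw_residue[of b] unfolding bij_betw_def inj_on_def by blast+
    then have "lin b k' r' w' = lin b k r w"
      using lin_red[of b k r w] lin_red[of b k' r w] by simp
    then have "lin b k r w + (k' + k' + k' + k') = lin b k r w + (k + k + k + k)"
      using trans[OF k'(4) eqm[symmetric]] by (simp only:)
    then have "k' + k' + k' + k' = k + k + k + k" by (rule add_left_imp_eq)
    then show ?thesis using eq by (cases k; cases k') simp
  qed
  show ?thesis
  proof (rule ex1I[of _ "(k, r, w)"], unfold split_paired_all prod.case prod.inject)
    show "even3 k \<and> r < 6 \<and> w \<in> set mids \<and> lin b k r w + (k + k + k + k) = m"
      using krw eqm by blast
  qed (use unique in blast)
qed

section \<open>The coverings\<close>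

definition placed :: "bool \<Rightarrow> int triple \<Rightarrow> nat \<Rightarrow> curve" where
  "placed b k r = curve_image (motion b k r) curve_C"

definition covering :: "bool \<Rightarrow> curve set" where
  "covering b = {placed b k r | k r. even3 k \<and> r < 6}"

lemma placed_in_covering: "even3 k \<Longrightarrow> r < 6 \<Longrightarrow> placed b k r \<in> covering b"
  unfolding covering_def by blast

lemma covering_cases:
  assumes "c \<in> covering b"
  obtains k r where "c = placed b k r" "even3 k" "r < 6"
  using assms unfolding covering_def by blast

lemma curve_C_eq: "curve_C = curve_of_vertices (map pt verts)"
  by (simp add: curve_C_def verts_def pt_def)

lemma curve_segments_curve_C: "curve_segments curve_C = edge ` set mids"
proof -
  have "{f n | n. Suc n < length (map pt verts)} = f ` {..<8}" for f :: "nat \<Rightarrow> segment"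
    by (auto simp: verts_def)
  moreover have "{..<8::nat} = {0, 1, 2, 3, 4, 5, 6, 7}" by auto
  ultimately show ?thesis
    unfolding curve_C_eq curve_segments_curve_of_vertices
    by (simp only:) (simp add: verts_def mids_def closed_segment_eq_edge adjacent_def units_def
        zero_prod_def)
qed

lemma curve_segments_curve_image:
  "curve_segments (curve_image f c) = image f ` curve_segments c"
  unfolding curve_segments_def curve_image_def
  by (auto simp: ran_def image_iff)

lemma one_odd_mids: "w \<in> set mids \<Longrightarrow> one_odd w"
  by (auto simp: mids_def one_odd_def)

lemma curve_segments_placed:
  assumes "even3 k" "r < 6"
  shows "curve_segments (placed b k r) = (\<lambda>w. edge (lin b k r w + (k + k + k + k))) ` set mids"
  unfolding placed_def curve_segments_curve_image curve_segments_curve_C image_image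
  using assms one_odd_mids by (intro image_cong) (simp_all add: motion_edge)

lemma edge_in_placed_iff:
  assumes "even3 k" "r < 6"
  shows "edge m \<in> curve_segments (placed b k r) \<longleftrightarrow>
    (\<exists>w\<in>set mids. lin b k r w + (k + k + k + k) = m)"
  unfolding curve_segments_placed[OF assms] using inj_edge by (auto simp: inj_eq)

lemma placed_eq_curve_of_vertices:
  assumes "even3 k" "r < 6"
  shows "placed b k r = curve_of_vertices (map (motion b k r) (map pt verts))"
  unfolding placed_def curve_C_eq
  by (rule curve_image_curve_of_vertices[OF positive_isometry_motion[OF assms(2,1)]])

lemma is_curve_placed:
  assumes "even3 k" "r < 6"
  shows "is_curve (placed b k r)" "self_avoiding (placed b k r)"
proof -
  let ?vs = "map (motion b k r) (map pt verts)"
  have "?vs = map pt (map (\<lambda>v. lin b k r v + (k + k)) verts)"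
    using assms(2) by (simp add: motion_pt)
  moreover have "distinct verts" by (simp add: verts_def)
  ultimately have dist: "distinct ?vs"
    using assms(2) by (simp add: distinct_map inj_on_def lin_eq_iff del: map_map)
  have "curve_segments (placed b k r) \<subseteq> segments"
    unfolding curve_segments_placed[OF assms] segments_eq
    using motion_edge(2)[OF assms(2,1) one_odd_mids] by blast
  \<comment> \<open>The set of segments of the curve is already known to consist of unit segments,
    so no single pair of vertices needs inspection.\<close>
  then have "closed_segment (?vs ! n) (?vs ! Suc n) \<in> segments" if "Suc n < length ?vs" for n
    using that unfolding placed_eq_curve_of_vertices[OF assms] curve_segments_curve_of_vertices
    by blast
  moreover have "2 \<le> length ?vs" by (simp add: verts_def)
  ultimately show "is_curve (placed b k r)"
    unfolding placed_eq_curve_of_vertices[OF assms]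
    using dist by (intro is_curve_curve_of_vertices)
  show "self_avoiding (placed b k r)"
    unfolding placed_eq_curve_of_vertices[OF assms]
    using dist by (rule self_avoiding_curve_of_vertices)
qed

text \<open>Equal curves share a segment, and by \<open>ex1_place\<close> one segment already fixes
  k and r. The triple (3,0,0) is the doubled midpoint of the last segment of C.\<close>

lemma placed_eq_iff:
  assumes "even3 k" "r < 6" "even3 k'" "r' < 6"
  shows "placed b k r = placed b k' r' \<longleftrightarrow> k = k' \<and> r = r'"
proof
  assume eq: "placed b k r = placed b k' r'"
  let ?m = "lin b k r (3, 0, 0) + (k + k + k + k)"
  have w: "(3, 0, 0) \<in> set mids" by (simp add: mids_def)
  then have "edge ?m \<in> curve_segments (placed b k' r')"
    unfolding eq[symmetric] edge_in_placed_iff[OF assms(1,2)] by blast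
  then obtain w' where "w' \<in> set mids" "lin b k' r' w' + (k' + k' + k' + k') = ?m"
    unfolding edge_in_placed_iff[OF assms(3,4)] by blast
  moreover have "one_odd ?m" using motion_edge(2)[OF assms(2,1) one_odd_mids[OF w]] .
  ultimately show "k = k' \<and> r = r'"
    using ex1_place[of ?m b] assms w unfolding Ex1_def by blast
qed simp

lemma is_covering_covering: "is_covering (covering b)"
proof -
  have "\<exists>!c. c \<in> covering b \<and> a \<in> curve_segments c" if "a \<in> segments" for a
  proof -
    obtain m where m: "a = edge m" "one_odd m" using \<open>a \<in> segments\<close> unfolding segments_eq by blast
    obtain k r w where krw: "even3 k" "r < 6" "w \<in> set mids" "lin b k r w + (k + k + k + k) = m"
      and unique: "\<And>k' r' w'. even3 k' \<Longrightarrow> r' < 6 \<Longrightarrow> w' \<in> set mids \<Longrightarrow>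
        lin b k' r' w' + (k' + k' + k' + k') = m \<Longrightarrow> k' = k \<and> r' = r"
      using ex1_place[OF m(2), of b] unfolding Ex1_def by blast
    show ?thesis
    proof (rule ex1I)
      show "placed b k r \<in> covering b \<and> a \<in> curve_segments (placed b k r)"
        using krw placed_in_covering unfolding m(1) edge_in_placed_iff[OF krw(1,2)] by blast
    next
      fix c assume "c \<in> covering b \<and> a \<in> curve_segments c"
      then obtain k' r' where c: "c = placed b k' r'" "even3 k'" "r' < 6"
          "edge m \<in> curve_segments (placed b k' r')"
        unfolding covering_def m(1) by blast
      then obtain w' where "w' \<in> set mids" "lin b k' r' w' + (k' + k' + k' + k') = m"
        unfolding edge_in_placed_iff[OF c(2,3)] by blast
      then show "c = placed b k r" using unique c by blast
    qed
  qed
  moreover have "is_curve c \<and> self_avoiding c" if "c \<in> covering b" for c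
    using that is_curve_placed unfolding covering_def by blast
  ultimately show ?thesis unfolding is_covering_def by blast
qed

section \<open>Endpoints of the placed curves\<close>

text \<open>Endpoint types quantify over all isometries realizing a curve; this makes the answer
  independent of the choice.\<close>

lemma curve_image_curve_C_inject:
  assumes "positive_isometry f" "positive_isometry g"
    and "curve_image f curve_C = curve_image g curve_C" "v \<in> set verts"
  shows "f (pt v) = g (pt v)"
proof -
  let ?us = "map f (map pt verts)" and ?vs = "map g (map pt verts)"
  have inj: "inj_on h A" if "positive_isometry h" for h :: "real^3 \<Rightarrow> real^3" and A
  proof (rule inj_onI)
    fix x y assume "h x = h y"
    moreover have "dist (h x) (h y) = dist x y" using that by (simp add: positive_isometry_def)
    ultimately show "x = y" by simp
  qed
  have "distinct (map pt verts)" by (simp add: verts_def)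
  then have "distinct ?us" "distinct ?vs"
    using inj assms(1,2) by (simp_all only: distinct_map simp_thms)
  moreover have "length ?us = length ?vs" "3 \<le> length ?vs" by (simp_all add: verts_def)
  moreover have "curve_of_vertices ?us = curve_of_vertices ?vs"
    using assms(3) unfolding curve_C_eq
    by (simp only: curve_image_curve_of_vertices[OF assms(1)]
        curve_image_curve_of_vertices[OF assms(2)])
  txt \<open>The reversal is excluded by comparing the distances from each end of the curve to the
    third vertex after it, which are 1 and \<open>sqrt 3\<close>.\<close>
  ultimately consider "?us = ?vs" | "?us = rev ?vs"
    using curve_of_vertices_inject by blast
  then show ?thesis
  proof cases
    case 1
    then show ?thesis using assms(4) by (simp add: map_eq_conv)
  next
    case 2
    then have "f (pt (0, 0, 0)) = g (pt (2, 0, 0))" "f (pt (0, 0, - 1)) = g (pt (1, - 1, - 1))"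
      by (simp_all add: verts_def)
    moreover have "dist (f x) (f y) = dist x y" "dist (g x) (g y) = dist x y" for x y
      using assms(1,2) by (simp_all add: positive_isometry_def)
    from this(1)[of "pt (0, 0, 0)" "pt (0, 0, - 1)"] this(2)[of "pt (2, 0, 0)" "pt (1, - 1, - 1)"]
    have "dist (f (pt (0, 0, 0))) (f (pt (0, 0, - 1))) = dist (pt (0, 0, 0)) (pt (0, 0, - 1))"
      "dist (g (pt (2, 0, 0))) (g (pt (1, - 1, - 1))) = dist (pt (2, 0, 0)) (pt (1, - 1, - 1))" .
    ultimately have "dist (pt (0, 0, 0)) (pt (0, 0, - 1)) = dist (pt (2, 0, 0)) (pt (1, - 1, - 1))"
      by simp
    then show ?thesis by (simp add: pt_def dist_vec_def L2_set_def sum_3 dist_real_def)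
  qed
qed

text \<open>\<open>motion b k r\<close> realizes the curve and sends 0 to 2k; every other realizing
  isometry agrees with it at 0.\<close>

lemma endpoint_type0_placed:
  assumes "even3 k" "r < 6"
  shows "endpoint_type0 (placed b k r) x \<longleftrightarrow> x = pt (k + k)"
proof -
  have 0: "(0 :: real^3) = pt (0, 0, 0)" by (simp add: pt_def vec3_eq_iff)
  have lin0: "lin b k r (0, 0, 0) = (0 :: int triple)"
    using assms(2) by (elim less_6_cases; cases k) (simp_all add: lin_def flip_def zero_prod_def)
  have val: "motion b k r 0 = pt (k + k)"
    unfolding 0 motion_pt[OF assms(2)] lin0 by simp
  have iso: "positive_isometry (motion b k r)" by (rule positive_isometry_motion[OF assms(2,1)])
  have "pt (k + k) = f 0" if "positive_isometry f" "placed b k r = curve_image f curve_C" for f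
    using curve_image_curve_C_inject[OF iso that(1) that(2)[unfolded placed_def], of "(0, 0, 0)"] val
    unfolding 0 by (simp add: verts_def)
  then show ?thesis
    unfolding endpoint_type0_def using iso placed_def val by metis
qed

text \<open>The same argument at the last vertex 2e_1. The value is written as a doubled triple, to
  be compared with \<open>q + q\<close> when counting.\<close>

lemma endpoint_type1_placed:
  assumes "even3 k" "r < 6"
  shows "endpoint_type1 (placed b k r) x \<longleftrightarrow>
    x = pt ((lin b k r (1, 0, 0) + k) + (lin b k r (1, 0, 0) + k))"
proof -
  have 2: "(vector [2, 0, 0] :: real^3) = pt (2, 0, 0)" by (simp add: pt_def)
  have "lin b k r (2, 0, 0) = lin b k r (1, 0, 0) + (lin b k r (1, 0, 0) :: int triple)"
    using lin_add[OF assms(2), of b k "(1, 0, 0)" "(1, 0, 0)"] by simp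
  then have val: "motion b k r (vector [2, 0, 0]) =
      pt ((lin b k r (1, 0, 0) + k) + (lin b k r (1, 0, 0) + k))"
    unfolding 2 motion_pt[OF assms(2)] by (simp add: algebra_simps)
  have iso: "positive_isometry (motion b k r)" by (rule positive_isometry_motion[OF assms(2,1)])
  have "motion b k r (vector [2, 0, 0]) = f (vector [2, 0, 0])"
    if "positive_isometry f" "placed b k r = curve_image f curve_C" for f
    using curve_image_curve_C_inject[OF iso that(1) that(2)[unfolded placed_def], of "(2, 0, 0)"]
    unfolding 2 by (simp add: verts_def)
  then show ?thesis
    unfolding endpoint_type1_def val[symmetric] using iso placed_def by metis
qed

text \<open>The endpoint forces k = q, so exactly the six rotations remain, and they give distinct
  curves.\<close>

lemma card_type0:
  assumes "even3 q"
  shows "card {c \<in> covering b. endpoint_type0 c (pt (q + q))} = 6"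
proof -
  have dbl: "k + k = q + q \<longleftrightarrow> k = q" for k by (cases k; cases q) auto
  have "c \<in> covering b \<and> endpoint_type0 c (pt (q + q)) \<longleftrightarrow> (\<exists>r<6. c = placed b q r)" for c
    using assms dbl[symmetric] endpoint_type0_placed[of _ _ b "pt (q + q)"]
    unfolding covering_def pt_eq_iff mem_Collect_eq by metis
  then have "{c \<in> covering b. endpoint_type0 c (pt (q + q))} = placed b q ` {..<6}" by blast
  moreover have "inj_on (placed b q) {..<6}"
    using assms by (auto simp: inj_on_def placed_eq_iff)
  ultimately show ?thesis by (simp add: card_image)
qed

text \<open>For each of the six rotations exactly one k satisfies
  \<open>lin b k r (1, 0, 0) + k = q\<close>: the unknown sign does not affect parities, so q and r
  fix the parity class of k, which in turn fixes the sign.\<close>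

lemma card_type1:
  assumes "\<not> even3 q"
  shows "card {c \<in> covering b. endpoint_type1 c (pt (q + q))} = 6"
proof -
  have dbl: "k + k = l + l \<longleftrightarrow> k = l" for k l :: "int triple" by (cases k; cases l) auto
  \<comment> \<open>The solution would be q minus plus or minus \<open>turn r (1, 0, 0)\<close>. The
    triple \<open>q + turn r (1, 0, 0)\<close> has the same parities for either sign and so stands
    in for k inside \<open>lin\<close>.\<close>
  define \<kappa> where "\<kappa> r = q - lin b (q + turn r (1, 0, 0)) r (1, 0, 0)" for r
  have \<kappa>: "even3 k \<and> lin b k r (1, 0, 0) + k = q \<longleftrightarrow> k = \<kappa> r" if "r < 6" for k r
  proof -
    have red: "red (q - lin b k r (1, 0, 0)) = red (q + turn r (1, 0, 0))" for k
      using that by (elim less_6_cases; cases k; cases q; cases b)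
        (simp_all add: lin_def flip_def sg_def red_def, presburger+)
    \<comment> \<open>A signed unit vector changes the parity of the coordinate sum, which is odd
      for q.\<close>
    have "even3 (\<kappa> r)"
      using that assms unfolding \<kappa>_def
      by (elim less_6_cases; cases k; cases q; cases b)
        (auto simp: lin_def flip_def sg_def even3_def)
    moreover have "lin b (\<kappa> r) r (1, 0, 0) = lin b (q + turn r (1, 0, 0)) r ((1, 0, 0) :: int triple)"
      unfolding \<kappa>_def by (metis red lin_red)
    moreover have "k = \<kappa> r" if "lin b k r (1, 0, 0) + k = q"
    proof -
      have k: "k = q - lin b k r (1, 0, 0)" using that by (simp add: algebra_simps)
      then have "lin b k r (1, 0, 0) = lin b (q + turn r (1, 0, 0)) r ((1, 0, 0) :: int triple)"
        by (metis red lin_red)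
      then show ?thesis using k by (simp add: \<kappa>_def)
    qed
    ultimately show ?thesis by (auto simp: \<kappa>_def)
  qed
  have "{c \<in> covering b. endpoint_type1 c (pt (q + q))} = (\<lambda>r. placed b (\<kappa> r) r) ` {..<6}"
    (is "?L = ?R")
  proof
    show "?L \<subseteq> ?R"
    proof
      fix c assume "c \<in> ?L"
      then obtain k r where c: "c = placed b k r" "even3 k" "r < 6" "endpoint_type1 c (pt (q + q))"
        unfolding covering_def by blast
      then have "lin b k r (1, 0, 0) + k = q" by (auto simp: endpoint_type1_placed dbl)
      then show "c \<in> ?R" using \<kappa>[of r k] c by auto
    qed
    show "?R \<subseteq> ?L"
    proof
      fix c assume "c \<in> ?R"
      then obtain r where r: "c = placed b (\<kappa> r) r" "r < 6" by blast
      then have "even3 (\<kappa> r)" "lin b (\<kappa> r) r (1, 0, 0) + \<kappa> r = q" using \<kappa> by blast+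
      then show "c \<in> ?L" using r by (auto simp: covering_def endpoint_type1_placed)
    qed
  qed
  moreover have "inj_on (\<lambda>r. placed b (\<kappa> r) r) {..<6}"
  proof (rule inj_onI)
    fix r s :: nat assume "r \<in> {..<6}" "s \<in> {..<6}" "placed b (\<kappa> r) r = placed b (\<kappa> s) s"
    moreover from this have "even3 (\<kappa> r)" "even3 (\<kappa> s)" using \<kappa> by blast+
    ultimately show "r = s" by (simp add: placed_eq_iff)
  qed
  ultimately show ?thesis by (simp add: card_image)
qed

lemma curve_C_eq_placed: "curve_C = placed b (0, 0, 0) 0"
proof -
  have "motion b (0, 0, 0) 0 x = x" for x
    by (simp add: motion_def lin_def flip_def sg_def pt_def vec3_eq_iff)
  then have "placed b (0, 0, 0) 0 = curve_image (\<lambda>x. x) curve_C"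
    unfolding placed_def by (metis ext)
  moreover have "curve_image (\<lambda>x. x) curve_C = curve_C"
    by (simp add: curve_image_def option.map_id0[unfolded id_def] cong: option.map_cong)
  ultimately show ?thesis by simp
qed

section \<open>Isometries acting on the coverings\<close>

text \<open>If composing with \<open>f\<close> only reindexes the motions, the placed curves are
  reindexed as well; surjectivity of the reindexing gives the whole target covering.\<close>

lemma image_covering:
  assumes "\<And>k r. even3 k \<Longrightarrow> r < 6 \<Longrightarrow> even3 (\<phi> k) \<and> \<rho> r < 6"
    and "\<And>k. even3 k \<Longrightarrow> \<exists>l. even3 l \<and> \<phi> l = k" "\<And>r. r < 6 \<Longrightarrow> \<exists>s<6. \<rho> s = r"
    and "\<And>k r x. r < 6 \<Longrightarrow> f (motion b k r x) = motion b' (\<phi> k) (\<rho> r) x"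
  shows "curve_image f ` covering b = covering b'"
proof -
  have eq: "curve_image f (placed b k r) = placed b' (\<phi> k) (\<rho> r)" if "r < 6" for k r
    unfolding placed_def curve_image_comp using assms(4)[OF that] by simp
  show ?thesis
  proof
    show "curve_image f ` covering b \<subseteq> covering b'"
      unfolding covering_def using eq assms(1) by blast
    show "covering b' \<subseteq> curve_image f ` covering b"
    proof
      fix c assume "c \<in> covering b'"
      then obtain k r where c: "c = placed b' k r" "even3 k" "r < 6"
        unfolding covering_def by blast
      then obtain l s where "even3 l" "\<phi> l = k" "s < 6" "\<rho> s = r" using assms(2,3) by meson
      then show "c \<in> curve_image f ` covering b"
        unfolding covering_def image_def c(1) using eq by blast
    qed
  qed
qed

text \<open>Translation by 4z replaces k by k + 2z, which leaves all parities and hence all signs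
  unchanged.\<close>

lemma translate_covering:
  assumes "v \<in> Z3"
  shows "curve_image (\<lambda>x. 4 *\<^sub>R v + x) ` covering b = covering b"
proof -
  obtain z where z: "v = pt z" using assms by (auto simp: Z3_eq_range_pt)
  have even: "even3 (k + (z + z)) = even3 k" for k
    by (cases k; cases z) (simp add: even3_def)
  have lin: "lin b (k + (z + z)) r = (lin b k r :: 'a::ring_1 triple \<Rightarrow> _)" for k r and b
  proof
    fix x :: "'a triple"
    show "lin b (k + (z + z)) r x = lin b k r x"
      by (cases k; cases z; cases "turn r x") (simp add: lin_def flip_def sg_def)
  qed
  show ?thesis
  proof (rule image_covering)
    fix k :: "int triple" and r :: nat
    show "even3 (k + (z + z)) \<and> r < 6" if "even3 k" "r < 6"
      using that by (simp add: even)
    show "\<exists>l. even3 l \<and> l + (z + z) = k" if "even3 k"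
      using that even[of "k - (z + z)"] by (intro exI[of _ "k - (z + z)"]) simp
    show "\<exists>s<6. s = r" if "r < 6" using that by blast
    show "4 *\<^sub>R v + motion b k r x = motion b (k + (z + z)) r x" for x
      unfolding motion_def lin z
      by (cases k; cases z; cases "lin b k r (x $ 1, x $ 2, x $ 3)")
        (simp add: pt_def vec3_eq_iff)
  qed
qed

text \<open>At k = 0 there are no sign changes, so the map is the half turn (x,y,z) to (-x,-z,-y).
  Exchanging the last two coordinates, both of points and of k, turns one sign rule into the other,
  and composing it with rotation r gives rotation r + 3 modulo 6.\<close>

lemma swap_covering: "curve_image (motion True 0 3) ` covering True = covering False"
proof (rule image_covering)
  fix k :: "int triple" and r :: nat
  let ?\<phi> = "turn 3 :: int triple \<Rightarrow> int triple"
  let ?\<rho> = "\<lambda>r. (r + 3) mod 6 :: nat"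
  show "even3 (?\<phi> k) \<and> ?\<rho> r < 6" if "even3 k" "r < 6"
    using that(2) by (rule less_6_cases; cases k) (use that in \<open>auto simp: even3_def\<close>)
  \<comment> \<open>Both reindexings are involutions, so each value is its own witness for a
    preimage.\<close>
  show "\<exists>l. even3 l \<and> ?\<phi> l = k" if "even3 k"
    using that by (intro exI[of _ "turn 3 k"]; cases k) (auto simp: even3_def)
  show "\<exists>s<6. ?\<rho> s = r" if "r < 6"
    using that by (intro exI[of _ "?\<rho> r"]) (auto elim: less_6_cases)
  show "motion True 0 3 (motion True k r x) = motion False (?\<phi> k) (?\<rho> r) x" if "r < 6" for x
    using that by (rule less_6_cases; cases k)
      (simp_all add: motion_def lin_def flip_def sg_def pt_def vec3_eq_iff zero_prod_def)
qed

text \<open>At k = (0,1,1) the two rules give the signs (-,-,+) and (-,+,-). If the curve with r = 0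
  lay in both coverings, the image of 0 would fix k, that of (2,0,0) would force r = 0, and that of
  (0,-1,0) would contradict the signs.\<close>

lemma coverings_differ: "covering True \<noteq> covering False"
proof
  let ?k = "(0, 1, 1) :: int triple"
  have k: "even3 ?k" by (simp add: even3_def)
  assume "covering True = covering False"
  then have "placed True ?k 0 \<in> covering False"
    using placed_in_covering[OF k, of 0 True] by simp
  then obtain k r where kr: "placed True ?k 0 = placed False k r" "even3 k" "r < 6"
    by (rule covering_cases)
  have "positive_isometry (motion True ?k 0)" "positive_isometry (motion False k r)"
    using positive_isometry_motion kr(2,3) k by simp_all
  then have "motion True ?k 0 (pt v) = motion False k r (pt v)" if "v \<in> set verts" for v
    using curve_image_curve_C_inject kr(1) that unfolding placed_def by blast
  then have eq: "lin True ?k 0 v + (?k + ?k) = lin False k r v + (k + k)"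
    if "v \<in> set verts" for v
    using that kr(3) by (simp only: motion_pt pt_eq_iff zero_less_numeral)
  have verts: "(0, 0, 0) \<in> set verts" "(0, - 1, 0) \<in> set verts" "(2, 0, 0) \<in> set verts"
    by (simp_all add: verts_def)
  have "k = ?k"
    using eq[OF verts(1)] kr(3)
    by (elim less_6_cases; cases k) (simp_all add: lin_def flip_def)
  then show False
    using eq[OF verts(2)] eq[OF verts(3)] kr(3)
    by (elim less_6_cases) (simp_all add: lin_def flip_def sg_def)
qed

theorem theorem2p1:
  shows "\<exists>C1 C2 :: curve set.
    C1 \<noteq> C2 \<and> equivalent_curve_sets C1 C2 \<and>
    (\<forall>K\<in>{C1, C2}.
       is_covering K \<and> (\<forall>c\<in>K. equivalent_curves curve_C c) \<and> curve_C \<in> K \<and>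
       (\<forall>v\<in>Z3. curve_image (\<lambda>x. 4 *\<^sub>R v + x) ` K = K) \<and>
       (\<forall>k l m :: int. even (k + l + m) \<longrightarrow>
          card {c \<in> K. endpoint_type0 c
                  (vector [2 * of_int k, 2 * of_int l, 2 * of_int m])} = 6) \<and>
       (\<forall>k l m :: int. odd (k + l + m) \<longrightarrow>
          card {c \<in> K. endpoint_type1 c
                  (vector [2 * of_int k, 2 * of_int l, 2 * of_int m])} = 6) \<and>
       (\<forall>x\<in>Z3. (\<nexists>k l m :: int. x = vector [2 * of_int k, 2 * of_int l, 2 * of_int m]) \<longrightarrow>
          (\<forall>c\<in>K. \<not> endpoint_type0 c x \<and> \<not> endpoint_type1 c x)))"
proof -
  have vec: "vector [2 * of_int k, 2 * of_int l, 2 * of_int m] = pt ((k, l, m) + (k, l, m))"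
    for k l m
    by (simp add: pt_def)
  have endpoints: "\<exists>k l m. x = pt ((k, l, m) + (k, l, m))"
    if "c \<in> covering b" "endpoint_type0 c x \<or> endpoint_type1 c x" for b c x
  proof -
    from that(1) obtain k r where c: "c = placed b k r" "even3 k" "r < 6"
      by (rule covering_cases)
    then have "\<exists>k. x = pt (k + k)"
      using that(2) unfolding c(1) endpoint_type0_placed[OF c(2,3)] endpoint_type1_placed[OF c(2,3)]
      by blast
    \<comment> \<open>One quantifier over a triple becomes the three integer quantifiers of the
      goal.\<close>
    then show ?thesis unfolding split_paired_Ex .
  qed
  have "equivalent_curve_sets (covering True) (covering False)"
    unfolding equivalent_curve_sets_def swap_covering[symmetric]
    using positive_isometry_motion[of 3 0 True] by (auto simp: even3_def zero_prod_def)
  moreover have "equivalent_curves curve_C c" if "c \<in> covering b" for b c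
    using that positive_isometry_motion
    unfolding equivalent_curves_def covering_def placed_def by blast
  moreover have "curve_C \<in> covering b" for b
    by (subst curve_C_eq_placed[of b]) (simp add: placed_in_covering even3_def)
  moreover have "card {c \<in> covering b. endpoint_type0 c (pt ((k, l, m) + (k, l, m)))} = 6"
    if "even (k + l + m)" for b k l m
    using that by (intro card_type0) (simp add: even3_def)
  moreover have "card {c \<in> covering b. endpoint_type1 c (pt ((k, l, m) + (k, l, m)))} = 6"
    if "odd (k + l + m)" for b k l m
    using that by (intro card_type1) (simp add: even3_def)
  ultimately have "covering True \<noteq> covering False \<and>
    equivalent_curve_sets (covering True) (covering False) \<and>
    (\<forall>K\<in>{covering True, covering False}.
       is_covering K \<and> (\<forall>c\<in>K. equivalent_curves curve_C c) \<and> curve_C \<in> K \<and>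
       (\<forall>v\<in>Z3. curve_image (\<lambda>x. 4 *\<^sub>R v + x) ` K = K) \<and>
       (\<forall>k l m :: int. even (k + l + m) \<longrightarrow>
          card {c \<in> K. endpoint_type0 c (pt ((k, l, m) + (k, l, m)))} = 6) \<and>
       (\<forall>k l m :: int. odd (k + l + m) \<longrightarrow>
          card {c \<in> K. endpoint_type1 c (pt ((k, l, m) + (k, l, m)))} = 6) \<and>
       (\<forall>x\<in>Z3. (\<nexists>k l m :: int. x = pt ((k, l, m) + (k, l, m))) \<longrightarrow>
          (\<forall>c\<in>K. \<not> endpoint_type0 c x \<and> \<not> endpoint_type1 c x)))"
    using coverings_differ is_covering_covering translate_covering endpoints
    by (simp del: pt_eq_iff add_Pair) metis
  then show ?thesis unfolding vec by blast
qed

end
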